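(* Let $\Omega \subset \mathbb{R}^n$ be a domain, let $N := \dim \mathbb{P}_d(\Omega)$, and let $K \subset \mathbb{R}^n$ be a compact set. Suppose that there exists a non-degenerate family of affinities $\varphi_i(x) = Ax + \xi_i$, $i = 1,\dots,N$, where $A$ is a fixed $n\times n$ real matrix with $\det A \neq 0$ and $\xi_i \in \mathbb{R}^n$, such that $K_i := \varphi_i(K) = AK + \xi_i$ for $i=1,\dots,N$. If $\{\xi_i\}_{i=1}^N$ is a unisolvent set for nodal interpolation in $\mathbb{P}_d(\Omega)$, then $\{K_i\}_{i=1}^N$ is a unisolvent set for integral interpolation in $\mathbb{P}_d(\Omega)$.
   Context: $\mathbb{P}_d(\Omega)$ is the space of (restrictions to $\Omega$ of) real polynomials in $n$ variables of total degree at most $d$, identified with $\mathbb{P}_d(\mathbb{R}^n)$; $\mu$ is Lebesgue measure. Throughout, "compact set" means the closure $K$ of an open connected set $U \subset \mathbb{R}^n$ with $0 < \mu(K) = \mu(U) < +\infty$. Notation: $AK + \xi := \{Ax + \xi \mid x \in K\}$. A set of nodes $\{\xi_i\}_{i=1}^N$ is unisolvent for nodal interpolation in $\mathbb{P}_d$ if $p\in \mathbb{P}_d$ and $p(\xi_i) = 0$ for all $i$ imply $p = 0$. A collection of compact sets $\{K_i\}_{i=1}^N$ is unisolvent for integral interpolation in $\mathbb{P}_d$ if $p \in \mathbb{P}_d$ and $\int_{K_i} p(x)\,dx = 0$ for all $i$ imply $p = 0$. *)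

theory Defs
  imports "HOL-Analysis.Analysis" "HOL-Library.Function_Algebras"
begin

text \<open>Real-valued functions as a real vector space under the pointwise operations of
  \<^theory>\<open>HOL-Library.Function_Algebras\<close>; this provides \<open>fun_space.span\<close> and \<open>fun_space.dim\<close>.\<close>

interpretation fun_space: vector_space "\<lambda>(c::real) (f::'a \<Rightarrow> real) x. c * f x"
  by unfold_locales (auto simp: fun_eq_iff algebra_simps)

definition monomial_fun :: "('n::finite \<Rightarrow> nat) \<Rightarrow> real ^ 'n \<Rightarrow> real"
  where "monomial_fun \<alpha> x = (\<Prod>k\<in>UNIV. (x $ k) ^ \<alpha> k)"

definition poly_space :: "nat \<Rightarrow> (real ^ 'n::finite \<Rightarrow> real) set"
  where "poly_space d = fun_space.span {monomial_fun \<alpha> |\<alpha>. (\<Sum>k\<in>UNIV. \<alpha> k) \<le> d}"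

text \<open>The space of restrictions of these polynomials to \<open>\<Omega>\<close>. A function on \<open>\<Omega>\<close> is
  represented by its extension by \<open>0\<close>, so that restriction is linear.\<close>

definition poly_space_on :: "nat \<Rightarrow> (real ^ 'n::finite) set \<Rightarrow> (real ^ 'n \<Rightarrow> real) set"
  where "poly_space_on d \<Omega> = (\<lambda>p x. if x \<in> \<Omega> then p x else 0) ` poly_space d"

text \<open>The convention for ``compact set''. Boundedness is not part of it: only finite
  measure is required.\<close>

definition compact_set :: "(real ^ 'n::finite) set \<Rightarrow> bool"
  where "compact_set K \<longleftrightarrow>
    (\<exists>U. open U \<and> connected U \<and> K = closure U \<and>
         0 < emeasure lebesgue K \<and> emeasure lebesgue K = emeasure lebesgue U \<and>
         emeasure lebesgue U < \<infinity>)"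

text \<open>Nodes and integration domains may lie outside \<open>\<Omega>\<close>, so unisolvence uses the
  identification of polynomials on \<open>\<Omega>\<close> with polynomials on the whole space.\<close>

definition nodal_unisolvent ::
    "nat \<Rightarrow> 'i set \<Rightarrow> ('i \<Rightarrow> real ^ 'n::finite) \<Rightarrow> bool"
  where "nodal_unisolvent d I \<xi> \<longleftrightarrow>
    (\<forall>p\<in>poly_space d. (\<forall>i\<in>I. p (\<xi> i) = 0) \<longrightarrow> p = (\<lambda>_. 0))"

text \<open>As sets admitted by \<^const>\<open>compact_set\<close> may be unbounded, a vanishing integral has to
  include integrability: the library integral of a non-integrable function is \<open>0\<close>. On
  bounded sets polynomials are always integrable and the extra conjunct is void.\<close>

definition integral_unisolvent ::
    "nat \<Rightarrow> 'i set \<Rightarrow> ('i \<Rightarrow> (real ^ 'n::finite) set) \<Rightarrow> bool"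
  where "integral_unisolvent d I K \<longleftrightarrow>
    (\<forall>p\<in>poly_space d.
      (\<forall>i\<in>I. set_integrable lebesgue (K i) p \<and> (LINT x:K i|lebesgue. p x) = 0) \<longrightarrow>
      p = (\<lambda>_. 0))"

end

theory Submission
  imports Defs
begin

text \<open>Let \<open>L = A K\<close>, so that \<open>K\<^sub>i = L + \<xi>\<^sub>i\<close>. Since the number of nodes is the dimension, there is a
  Lagrange basis \<open>l\<^sub>i\<close>, and interpolating \<open>z \<mapsto> p (y + z)\<close> gives
  \<open>p (y + z) = (\<Sum>i. l\<^sub>i z * p (y + \<xi>\<^sub>i))\<close>. Integrating over \<open>y \<in> L\<close> shows that every translate of
  \<open>p\<close> is integrable over \<open>L\<close> with integral zero; this also disposes of unbounded \<open>L\<close>, over which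
  other polynomials of degree at most \<open>d\<close> need not be integrable. The differences
  \<open>p (y + h) - p y\<close> inherit this property and have smaller degree, so by induction they vanish.
  Hence \<open>p\<close> is constant, and it is zero because \<open>L\<close> has positive measure.\<close>

section \<open>Finite-dimensional spaces of functions\<close>

text \<open>Two domain types are allowed because evaluation at nodes maps functions of points to
  functions of indices.\<close>

abbreviation fun_linear :: "(('a \<Rightarrow> real) \<Rightarrow> 'b \<Rightarrow> real) \<Rightarrow> bool"
  where "fun_linear \<equiv> Vector_Spaces.linear (\<lambda>c f x. c * f x) (\<lambda>c f x. c * f x)"

interpretation fun_pair: vector_space_pair
  "\<lambda>(c::real) (f::'a \<Rightarrow> real) x. c * f x" "\<lambda>(c::real) (f::'b \<Rightarrow> real) x. c * f x"
  by unfold_locales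

lemma fun_linearI:
  assumes "\<And>f g. T (f + g) = T f + T g" and "\<And>c f. T (\<lambda>x. c * f x) = (\<lambda>x. c * T f x)"
  shows "fun_linear T"
  unfolding Vector_Spaces.linear_iff
  by (intro conjI allI fun_space.vector_space_axioms assms)

lemma sum_fun_apply: "(\<Sum>i\<in>I. f i) x = (\<Sum>i\<in>I. f i x :: real)"
  by (induction I rule: infinite_finite_induct) auto

text \<open>The image of a basis of \<open>V\<close> spans the image of \<open>V\<close>. The finite
  spanning set \<open>S\<close> keeps that basis finite; an infinite one would have
  \<open>card\<close> equal to 0.\<close>

lemma dim_linear_image_le:
  assumes "fun_linear T" and "finite S" and "V \<subseteq> fun_space.span S"
  shows "fun_space.dim (T ` V) \<le> fun_space.dim V"
proof -
  obtain B where B: "B \<subseteq> V" "fun_space.independent B" "V \<subseteq> fun_space.span B"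
    "card B = fun_space.dim V"
    using fun_space.basis_exists[of V] by blast
  have fin: "finite B"
    using fun_space.independent_span_bound[OF \<open>finite S\<close> B(2)] B(1) assms(3) by blast
  have "T ` V \<subseteq> fun_space.span (T ` B)"
    using fun_pair.linear_span_image[OF assms(1), of B] B(3) by blast
  then have "fun_space.dim (T ` V) \<le> card (T ` B)"
    using fin by (intro fun_space.dim_le_card) auto
  also have "\<dots> \<le> fun_space.dim V"
    using card_image_le[OF fin, of T] B(4) by simp
  finally show ?thesis .
qed

text \<open>Unisolvence makes evaluation at the nodes injective on \<open>V\<close>. Since
  \<open>V\<close> has at least as many dimensions as there are indices, evaluation is also onto,
  and preimages of the unit vectors serve as \<open>l\<close>.\<close>

lemma lagrange_basis_exists:
  fixes V :: "('a \<Rightarrow> real) set" and \<xi> :: "'i \<Rightarrow> 'a"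
  assumes V: "fun_space.subspace V" and I: "finite I" and dim: "card I \<le> fun_space.dim V"
    and unisolvent: "\<And>p. p \<in> V \<Longrightarrow> (\<forall>i\<in>I. p (\<xi> i) = 0) \<Longrightarrow> p = 0"
  obtains l where "\<And>i. i \<in> I \<Longrightarrow> l i \<in> V"
    and "\<And>p z. p \<in> V \<Longrightarrow> p z = (\<Sum>i\<in>I. p (\<xi> i) * l i z)"
proof -
  \<comment> \<open>The value 0 outside \<open>I\<close> puts all evaluations in the span of the
    finitely many unit vectors \<open>e i\<close> with \<open>i\<close> in \<open>I\<close>, so
    dimensions can be counted.\<close>
  define E where "E p = (\<lambda>i. if i \<in> I then p (\<xi> i) else 0)" for p :: "'a \<Rightarrow> real"
  define e :: "'i \<Rightarrow> 'i \<Rightarrow> real" where "e i j = (if j = i then 1 else 0)" for i j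
  have E: "fun_linear E"
    by (rule fun_linearI) (auto simp: E_def fun_eq_iff)
  obtain B where B: "B \<subseteq> V" "fun_space.independent B" "V \<subseteq> fun_space.span B"
    "card B = fun_space.dim V"
    using fun_space.basis_exists[of V] by blast
  have spanB: "fun_space.span B = V"
    using B V by (simp add: fun_space.span_subspace)
  have inj: "inj_on E V"
  proof (rule inj_onI)
    fix p q assume pq: "p \<in> V" "q \<in> V" "E p = E q"
    have "(p - q) (\<xi> i) = 0" if "i \<in> I" for i
      using fun_cong[OF pq(3), of i] that by (simp add: E_def)
    then have "p - q = 0"
      using fun_space.subspace_diff[OF V pq(1,2)] by (intro unisolvent ballI)
    then show "p = q" by simp
  qed
  have indep: "fun_space.independent (E ` B)"
    using fun_pair.linear_independent_injective_image[OF E B(2)] inj spanB by simp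
  have span_e: "f \<in> fun_space.span (e ` I)" if "\<And>j. j \<notin> I \<Longrightarrow> f j = 0" for f
  proof -
    have "f = (\<Sum>i\<in>I. (\<lambda>j. f i * e i j))"
      using that I by (auto simp: fun_eq_iff sum_fun_apply e_def if_distrib cong: if_cong)
    moreover have "\<dots> \<in> fun_space.span (e ` I)"
      by (intro fun_space.span_sum fun_space.span_scale fun_space.span_base) auto
    ultimately show ?thesis by simp
  qed
  \<comment> \<open>Otherwise \<open>e i\<close> and the evaluations of \<open>B\<close> would be
    \<open>dim V + 1\<close> independent vectors in a space spanned by at most \<open>card I\<close>
    vectors.\<close>
  have "e i \<in> E ` V" if i: "i \<in> I" for i
  proof (rule ccontr)
    assume "e i \<notin> E ` V"
    then have notin: "e i \<notin> fun_space.span (E ` B)"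
      using fun_pair.linear_span_image[OF E, of B] spanB by simp
    have "insert (e i) (E ` B) \<subseteq> fun_space.span (e ` I)"
    proof
      fix f assume "f \<in> insert (e i) (E ` B)"
      then show "f \<in> fun_space.span (e ` I)"
        using i by (intro span_e) (auto simp: E_def e_def)
    qed
    moreover have "fun_space.independent (insert (e i) (E ` B))"
      using notin indep by (rule fun_space.independent_insertI)
    ultimately have *: "finite (insert (e i) (E ` B)) \<and>
        card (insert (e i) (E ` B)) \<le> card (e ` I)"
      using I by (intro fun_space.independent_span_bound finite_imageI)
    have "card (E ` B) = card B"
      by (rule card_image[OF inj_on_subset[OF inj B(1)]])
    moreover have "e i \<notin> E ` B"
      using notin fun_space.span_base[of "e i" "E ` B"] by auto
    ultimately have "Suc (fun_space.dim V) \<le> card (e ` I)"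
      using * B(4) by auto
    also have "\<dots> \<le> card I"
      using I by (rule card_image_le)
    finally show False using dim by simp
  qed
  then have "\<forall>i\<in>I. \<exists>q. q \<in> V \<and> e i = E q"
    by blast
  then obtain l where "\<forall>i\<in>I. l i \<in> V \<and> e i = E (l i)"
    by (rule bchoice[THEN exE])
  then have l: "l i \<in> V" "E (l i) = e i" if "i \<in> I" for i
    using that by simp_all
  have l_node: "l i (\<xi> j) = (if j = i then 1 else 0)" if "i \<in> I" "j \<in> I" for i j
    using fun_cong[OF l(2)[OF that(1)], of j] that by (simp add: E_def e_def)
  have "p z = (\<Sum>i\<in>I. p (\<xi> i) * l i z)" if p: "p \<in> V" for p z
  proof -
    \<comment> \<open>The interpolation error lies in \<open>V\<close> and vanishes at every node,
      so unisolvence forces it to be zero.\<close>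
    let ?r = "p - (\<Sum>i\<in>I. (\<lambda>z. p (\<xi> i) * l i z))"
    have "?r \<in> V"
      using p l(1) V
      by (intro fun_space.subspace_diff fun_space.subspace_sum fun_space.subspace_scale)
    moreover have "\<forall>j\<in>I. ?r (\<xi> j) = 0"
      using I by (simp add: sum_fun_apply l_node if_distrib cong: if_cong sum.cong)
    ultimately have "?r = 0"
      by (rule unisolvent)
    from fun_cong[OF this, of z] show ?thesis by (simp add: sum_fun_apply)
  qed
  with l(1) show thesis by (rule that)
qed

section \<open>Differences of polynomials\<close>

lemma subspace_poly_space: "fun_space.subspace (poly_space d)"
  by (simp add: poly_space_def)

lemmas poly_space_add = fun_space.subspace_add[OF subspace_poly_space]
  and poly_space_scale = fun_space.subspace_scale[OF subspace_poly_space]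

lemma monomial_fun_in_poly_space:
  "(\<Sum>k\<in>UNIV. \<alpha> k) \<le> d \<Longrightarrow> monomial_fun \<alpha> \<in> poly_space d"
  unfolding poly_space_def by (rule fun_space.span_base) auto

lemma poly_space_induct [consumes 1, case_names zero step]:
  assumes "p \<in> poly_space d" and "P 0"
    and "\<And>c \<alpha> q. (\<Sum>k\<in>UNIV. \<alpha> k) \<le> d \<Longrightarrow> P q \<Longrightarrow> P ((\<lambda>x. c * monomial_fun \<alpha> x) + q)"
  shows "P p"
  using assms(1) unfolding poly_space_def
proof (rule fun_space.span_induct_alt)
  show "P 0" by (rule assms(2))
  show "P ((\<lambda>x. c * f x) + q)"
    if "f \<in> {monomial_fun \<alpha> |\<alpha>. (\<Sum>k\<in>UNIV. \<alpha> k) \<le> d}" and "P q" for c f q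
    using that assms(3) by auto
qed

lemma poly_space_mono:
  assumes "d \<le> e" shows "poly_space d \<subseteq> poly_space e"
  unfolding poly_space_def using assms by (intro fun_space.span_mono) auto

lemma finite_poly_space_generators:
  "finite {monomial_fun \<alpha> :: real ^ 'n::finite \<Rightarrow> real |\<alpha>. (\<Sum>k\<in>UNIV. \<alpha> k) \<le> d}"
proof -
  have "{\<alpha> :: 'n \<Rightarrow> nat. (\<Sum>k\<in>UNIV. \<alpha> k) \<le> d} \<subseteq> PiE UNIV (\<lambda>_. {..d})"
  proof (intro subsetI PiE_I)
    fix \<alpha> :: "'n \<Rightarrow> nat" and k
    assume "\<alpha> \<in> {\<alpha>. (\<Sum>k\<in>UNIV. \<alpha> k) \<le> d}"
    then show "\<alpha> k \<in> {..d}"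
      using member_le_sum[of k UNIV \<alpha>] by simp
  qed simp
  then have "finite {\<alpha> :: 'n \<Rightarrow> nat. (\<Sum>k\<in>UNIV. \<alpha> k) \<le> d}"
    by (rule finite_subset) (simp add: finite_PiE)
  then show ?thesis by (rule finite_image_set)
qed

text \<open>Restriction is linear and cannot raise the dimension. This bounds the number of nodes by
  the dimension of \<open>poly_space d\<close>, the direction that
  \<open>lagrange_basis_exists\<close> asks for.\<close>

lemma dim_poly_space_on_le:
  fixes \<Omega> :: "(real ^ 'n::finite) set"
  shows "fun_space.dim (poly_space_on d \<Omega>)
    \<le> fun_space.dim (poly_space d :: (real ^ 'n \<Rightarrow> real) set)"
  unfolding poly_space_on_def
proof (rule dim_linear_image_le)
  show "fun_linear (\<lambda>p x. if x \<in> \<Omega> then p x else 0)"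
    by (rule fun_linearI) (auto simp: fun_eq_iff)
  show "finite {monomial_fun \<alpha> :: real ^ 'n \<Rightarrow> real |\<alpha>. (\<Sum>k\<in>UNIV. \<alpha> k) \<le> d}"
    by (rule finite_poly_space_generators)
qed (simp add: poly_space_def)

lemma monomial_fun_upd_Suc:
  "monomial_fun (\<alpha>(k := Suc (\<alpha> k))) x = x $ k * monomial_fun \<alpha> x"
  by (simp add: monomial_fun_def prod.remove[of UNIV k] mult.assoc)

lemma sum_upd_Suc:
  fixes \<alpha> :: "'n::finite \<Rightarrow> nat"
  shows "(\<Sum>j\<in>UNIV. (\<alpha>(k := Suc (\<alpha> k))) j) = Suc (\<Sum>j\<in>UNIV. \<alpha> j)"
  by (simp add: sum.remove[of UNIV k])

lemma poly_space_mult_coordinate: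
  assumes "p \<in> poly_space d"
  shows "(\<lambda>x. x $ k * p x) \<in> poly_space (Suc d)"
  using assms
proof (induction rule: poly_space_induct)
  case zero
  then show ?case
    using fun_space.subspace_0[OF subspace_poly_space] by (simp add: zero_fun_def)
next
  case (step c \<alpha> q)
  let ?m = "monomial_fun (\<alpha>(k := Suc (\<alpha> k)))"
  have "?m \<in> poly_space (Suc d)"
    using step.hyps by (intro monomial_fun_in_poly_space) (simp only: sum_upd_Suc Suc_le_mono)
  then have "(\<lambda>x. c * ?m x) + (\<lambda>x. x $ k * q x) \<in> poly_space (Suc d)"
    using step.IH by (intro poly_space_add poly_space_scale)
  then show ?case
    by (simp add: monomial_fun_upd_Suc plus_fun_def algebra_simps)
qed

text \<open>Split off one factor \<open>x $ k\<close> from the monomial, leaving \<beta>, and let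
  \<open>D\<close> be the difference of the monomial of \<beta>. The full difference is
  \<open>x $ k * D + h $ k * (monomial_fun \<beta> + D)\<close>, so induction on the degree bound
  applies.\<close>

lemma monomial_fun_difference:
  assumes "(\<Sum>k\<in>UNIV. \<alpha> k) \<le> Suc d"
  shows "(\<lambda>x. monomial_fun \<alpha> (x + h) - monomial_fun \<alpha> x) \<in> poly_space d"
  using assms
proof (induction d arbitrary: \<alpha> rule: less_induct)
  case (less d)
  have zero: "(\<lambda>x. 0) \<in> poly_space e" for e
    using fun_space.subspace_0[OF subspace_poly_space] by (simp add: zero_fun_def)
  show ?case
  proof (cases "\<exists>k. \<alpha> k > 0")
    case False
    then show ?thesis using zero by (simp add: monomial_fun_def)
  next
    case True
    then obtain k where "\<alpha> k > 0" by blast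
    define \<beta> where "\<beta> = \<alpha>(k := \<alpha> k - 1)"
    have \<alpha>: "\<alpha> = \<beta>(k := Suc (\<beta> k))"
      using \<open>\<alpha> k > 0\<close> by (auto simp: \<beta>_def)
    have \<beta>: "(\<Sum>k\<in>UNIV. \<beta> k) \<le> d"
      using less.prems unfolding \<alpha> sum_upd_Suc by simp
    let ?D = "\<lambda>x. monomial_fun \<beta> (x + h) - monomial_fun \<beta> x"
    \<comment> \<open>For positive \<open>d\<close> the induction hypothesis puts \<open>?D\<close>
      one degree lower, which leaves room for the factor \<open>x $ k\<close>. For
      \<open>d = 0\<close> the monomial of \<beta> is constant and \<open>?D\<close>
      vanishes.\<close>
    have D: "?D \<in> poly_space d \<and> (\<lambda>x. x $ k * ?D x) \<in> poly_space d"
    proof (cases d)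
      case 0
      then have "\<beta> = (\<lambda>_. 0)" using \<beta> by (auto simp: fun_eq_iff)
      then show ?thesis using zero by (simp add: monomial_fun_def)
    next
      case (Suc e)
      then have "?D \<in> poly_space e" using less.IH[of e \<beta>] \<beta> by simp
      then show ?thesis
        using poly_space_mult_coordinate[of ?D e k] poly_space_mono[of e d] Suc by auto
    qed
    have "(\<lambda>x. x $ k * ?D x) + (\<lambda>x. h $ k * (monomial_fun \<beta> + ?D) x) \<in> poly_space d"
      using D monomial_fun_in_poly_space[OF \<beta>]
      by (intro poly_space_add poly_space_scale) auto
    then show ?thesis
      unfolding \<alpha> monomial_fun_upd_Suc by (simp add: plus_fun_def algebra_simps)
  qed
qed

lemma poly_space_difference:
  assumes "p \<in> poly_space (Suc d)"
  shows "(\<lambda>x. p (x + h) - p x) \<in> poly_space d"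
  using assms
proof (induction rule: poly_space_induct)
  case zero
  then show ?case
    using fun_space.subspace_0[OF subspace_poly_space] by (simp add: zero_fun_def)
next
  case (step c \<alpha> q)
  have "(\<lambda>x. c * (monomial_fun \<alpha> (x + h) - monomial_fun \<alpha> x)) + (\<lambda>x. q (x + h) - q x)
      \<in> poly_space d"
    using step monomial_fun_difference by (intro poly_space_add poly_space_scale) auto
  then show ?case
    by (simp add: plus_fun_def algebra_simps)
qed

text \<open>A translate is \<open>p\<close> plus its difference. Regarding \<open>p\<close> as an
  element of \<open>poly_space (Suc d)\<close> puts the difference in \<open>poly_space d\<close>,
  also for \<open>d = 0\<close>.\<close>

lemma poly_space_translate:
  assumes "p \<in> poly_space d"
  shows "(\<lambda>x. p (x + h)) \<in> poly_space d"
proof -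
  have "(\<lambda>x. p (x + h) - p x) \<in> poly_space d"
    using assms poly_space_mono[of d "Suc d"] by (intro poly_space_difference) auto
  from poly_space_add[OF this assms] show ?thesis
    by (simp add: plus_fun_def)
qed

lemma poly_space_0_const:
  assumes "p \<in> poly_space 0" shows "p x = p y"
  using assms by (induction rule: poly_space_induct) (auto simp: monomial_fun_def)

lemma continuous_on_poly_space:
  assumes "p \<in> poly_space d" shows "continuous_on S p"
  using assms
proof (induction rule: poly_space_induct)
  case zero
  then show ?case by (simp add: zero_fun_def)
next
  case (step c \<alpha> q)
  then show ?case
    unfolding plus_fun_def monomial_fun_def by (intro continuous_intros)
qed

lemma borel_measurable_poly_space:
  "p \<in> poly_space d \<Longrightarrow> p \<in> borel_measurable borel"
  by (intro borel_measurable_continuous_onI continuous_on_poly_space)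

section \<open>Integrals over translates\<close>

text \<open>Requiring the condition for all translates lets it pass to differences, so induction on
  the degree applies. Integrability is stated separately because a non-integrable function has
  integral 0 by default.\<close>

lemma vanishing_translate_integrals_imp_zero:
  fixes L :: "(real ^ 'n::finite) set"
  assumes "p \<in> poly_space d" and "emeasure lborel L \<noteq> 0"
    and "\<And>z. set_integrable lborel L (\<lambda>y. p (y + z))"
    and "\<And>z. (LINT y:L|lborel. p (y + z)) = 0"
  shows "p = (\<lambda>_. 0)"
  using assms(1,3,4)
proof (induction d arbitrary: p)
  \<comment> \<open>Both cases of the induction end with a constant \<open>p\<close>, so this case
    is settled once beforehand.\<close>
  have const: "p = (\<lambda>_. 0)"
    if const: "\<And>x. p x = p 0"
      and int: "\<And>z. set_integrable lborel L (\<lambda>y. p (y + z))"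
      and zero: "\<And>z. (LINT y:L|lborel. p (y + z)) = 0"
    for p :: "real ^ 'n \<Rightarrow> real"
  proof -
    have p: "p = (\<lambda>_. p 0)" using const by blast
    have "p 0 = 0"
    proof (rule ccontr)
      assume nz: "p 0 \<noteq> 0"
      have "integrable lborel (\<lambda>y. indicator L y * p 0)"
        using int[of 0] by (subst (asm) p) (simp add: set_integrable_def)
      \<comment> \<open>Integrability of a nonzero constant gives \<open>L\<close> finite measure,
        so \<open>measure\<close> being 0 below is not the default value for infinite
        \<open>emeasure\<close>.\<close>
      then have L: "integrable lborel (indicator L :: _ \<Rightarrow> real)"
        using nz by simp
      have "(LINT y|lborel. indicator L y * p 0) = 0"
        using zero[of 0] by (subst (asm) p) (simp add: set_lebesgue_integral_def)
      then have "measure lborel L = 0"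
        using nz by simp
      then show False
        using L assms(2) by (simp add: integrable_indicator_iff measure_def enn2real_eq_0_iff)
    qed
    with p show ?thesis by metis
  qed
  {
    case 0
    show ?case using poly_space_0_const[OF 0(1)] 0(2,3) by (rule const)
  next
    case (Suc d)
    have "(\<lambda>x. p (x + h) - p x) = (\<lambda>_. 0)" for h
    proof (rule Suc.IH)
      show "(\<lambda>x. p (x + h) - p x) \<in> poly_space d"
        using Suc.prems(1) by (rule poly_space_difference)
      fix z
      have int: "set_integrable lborel L (\<lambda>y. p (y + z + h))"
        "(LINT y:L|lborel. p (y + z + h)) = 0"
        using Suc.prems(2,3)[of "z + h"] by (simp_all add: add.assoc)
      show "set_integrable lborel L (\<lambda>y. p (y + z + h) - p (y + z))"
        using int(1) Suc.prems(2) by (rule set_integral_diff)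
      show "(LINT y:L|lborel. p (y + z + h) - p (y + z)) = 0"
        using set_integral_diff(2)[OF int(1) Suc.prems(2)[of z]] int(2) Suc.prems(3) by simp
    qed
    then have "p (0 + h) - p 0 = 0" for h by meson
    then have "p x = p 0" for x by (metis add_0 eq_iff_diff_eq_0)
    then show ?case using Suc.prems(2,3) by (rule const)
  }
qed

text \<open>For Borel integrands the completion changes neither integrability nor the integral, and
  \<open>lborel\<close> is translation invariant. The conditions on the different sets thus become
  conditions on translates of one function over \<open>L\<close>.\<close>

lemma set_integral_lebesgue_translation:
  fixes L :: "'a::euclidean_space set" and f :: "'a \<Rightarrow> real"
  assumes "L \<in> sets borel" and "f \<in> borel_measurable borel"
  shows "set_integrable lebesgue ((\<lambda>y. y + a) ` L) f \<longleftrightarrow> set_integrable lborel L (\<lambda>y. f (y + a))"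
    and "(LINT x:(\<lambda>y. y + a) ` L|lebesgue. f x) = (LINT y:L|lborel. f (y + a))"
proof -
  let ?g = "\<lambda>x. indicator ((\<lambda>y. y + a) ` L) x *\<^sub>R f x"
  \<comment> \<open>As a preimage under the inverse translation, the translated set is
    Borel.\<close>
  have "(\<lambda>y. y + a) ` L = (\<lambda>x. x - a) -` L"
    by (auto simp: image_iff) (metis diff_add_cancel)
  moreover have "(\<lambda>x. x - a) -` L \<in> sets borel"
    using measurable_sets[of "\<lambda>x. x - a" borel borel L] assms(1) by simp
  ultimately have g: "?g \<in> borel_measurable borel"
    using assms(2) by simp
  have shift: "?g (a + y) = indicator L y *\<^sub>R f (y + a)" for y
    by (auto simp: indicator_def add.commute)
  have "integrable lebesgue ?g \<longleftrightarrow> integrable (distr lborel borel ((+) a)) ?g"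
    using g by (simp add: integrable_completion lborel_distr_plus)
  also have "\<dots> \<longleftrightarrow> integrable lborel (\<lambda>y. ?g (a + y))"
    using g by (intro integrable_distr_eq) auto
  finally show "set_integrable lebesgue ((\<lambda>y. y + a) ` L) f \<longleftrightarrow>
      set_integrable lborel L (\<lambda>y. f (y + a))"
    by (simp only: set_integrable_def shift)
  have "integral\<^sup>L lebesgue ?g = integral\<^sup>L (distr lborel borel ((+) a)) ?g"
    using g by (simp add: integral_completion lborel_distr_plus)
  also have "\<dots> = (LINT y|lborel. ?g (a + y))"
    using g by (intro integral_distr) auto
  finally show "(LINT x:(\<lambda>y. y + a) ` L|lebesgue. f x) = (LINT y:L|lborel. f (y + a))"
    by (simp only: set_lebesgue_integral_def shift)
qed

text \<open>As \<open>K\<close> may be unbounded, closedness of the image comes from injectivity of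
  the linear map. The inverse matrix maps null sets to null sets, so a null image would make
  \<open>K\<close> null.\<close>

lemma compact_set_linear_image:
  fixes K :: "(real ^ 'n::finite) set"
  assumes "compact_set K" and "det A \<noteq> 0"
  shows "(*v) A ` K \<in> sets borel" and "emeasure lborel ((*v) A ` K) \<noteq> 0"
proof -
  from assms(1) have K: "closed K" "emeasure lebesgue K \<noteq> 0"
    by (auto simp: compact_set_def)
  have A: "invertible A"
    using assms(2) by (simp add: invertible_det_nz)
  then obtain B where B: "B ** A = mat 1"
    by (auto simp: invertible_def)
  have "closed ((*v) A ` K)"
    using K(1) A by (intro closed_injective_linear_image) (auto simp: inj_matrix_vector_mult)
  then show borel: "(*v) A ` K \<in> sets borel" by simp
  show "emeasure lborel ((*v) A ` K) \<noteq> 0"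
  proof
    assume "emeasure lborel ((*v) A ` K) = 0"
    then have "negligible ((*v) A ` K)"
      using borel by (simp add: negligible_iff_null_sets null_sets_def)
    then have "negligible ((*v) B ` (*v) A ` K)"
      by (rule negligible_differentiable_image_negligible[OF le_refl])
        (rule linear_imp_differentiable_on[OF matrix_vector_mul_linear])
    moreover have "(*v) B ` (*v) A ` K = K"
      using B by (simp add: image_image matrix_vector_mul_assoc)
    ultimately show False
      using K by (simp add: negligible_iff_null_sets null_sets_def)
  qed
qed

theorem proposition3p3:
  fixes \<Omega> K :: "(real ^ 'n::finite) set"
    and A :: "real ^ 'n ^ 'n"
    and d N :: nat
    and \<xi> :: "nat \<Rightarrow> real ^ 'n"
    and \<phi> :: "nat \<Rightarrow> real ^ 'n \<Rightarrow> real ^ 'n"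
    and Ks :: "nat \<Rightarrow> (real ^ 'n) set"
  assumes "open \<Omega>" and "connected \<Omega>" and "\<Omega> \<noteq> {}"
    and "N = fun_space.dim (poly_space_on d \<Omega>)"
    and "compact_set K"
    and "det A \<noteq> 0"
    and "\<And>i x. i \<in> {1..N} \<Longrightarrow> \<phi> i x = A *v x + \<xi> i"
    and "\<And>i. i \<in> {1..N} \<Longrightarrow> Ks i = \<phi> i ` K"
    and "nodal_unisolvent d {1..N} \<xi>"
  shows "integral_unisolvent d {1..N} Ks"
  unfolding integral_unisolvent_def
proof (intro ballI impI)
  fix p :: "real ^ 'n \<Rightarrow> real"
  assume p: "p \<in> poly_space d"
    and zero: "\<forall>i\<in>{1..N}. set_integrable lebesgue (Ks i) p \<and> (LINT x:Ks i|lebesgue. p x) = 0"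
  define L where "L = (*v) A ` K"
  note L = compact_set_linear_image[OF assms(5,6), folded L_def]
  have Ks: "Ks i = (\<lambda>y. y + \<xi> i) ` L" if "i \<in> {1..N}" for i
    using assms(7,8)[OF that] by (simp add: L_def image_image)
  note shift = set_integral_lebesgue_translation[OF L(1) borel_measurable_poly_space[OF p]]
  have node: "set_integrable lborel L (\<lambda>y. p (y + \<xi> i))" "(LINT y:L|lborel. p (y + \<xi> i)) = 0"
    if "i \<in> {1..N}" for i
    using zero that by (auto simp: Ks shift)
  obtain l where l: "\<And>q z. q \<in> poly_space d \<Longrightarrow> q z = (\<Sum>i\<in>{1..N}. q (\<xi> i) * l i z)"
  proof (rule lagrange_basis_exists[OF subspace_poly_space])
    show "card {1..N} \<le> fun_space.dim (poly_space d :: (real ^ 'n \<Rightarrow> real) set)"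
      using dim_poly_space_on_le[of d \<Omega>] assms(4) by simp
    show "q = 0" if "q \<in> poly_space d" "\<forall>i\<in>{1..N}. q (\<xi> i) = 0" for q
      using assms(9) that by (simp add: nodal_unisolvent_def zero_fun_def)
  qed auto
  \<comment> \<open>For fixed \<open>y\<close>, the translate of \<open>p\<close> by
    \<open>y\<close> is interpolated and read off at \<open>z\<close>. The coefficients
    \<open>l i z\<close> do not involve \<open>y\<close>, so integrating in \<open>y\<close> leaves
    only the integrals known from \<open>node\<close>.\<close>
  have interp: "(\<lambda>y. p (y + z)) = (\<lambda>y. \<Sum>i\<in>{1..N}. l i z * p (y + \<xi> i))" for z
    using l[OF poly_space_translate[OF p], of z] by (simp add: ac_simps)
  have int: "set_integrable lborel L (\<lambda>y. l i z * p (y + \<xi> i))" if "i \<in> {1..N}" for i z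
    using node(1)[OF that] by simp
  show "p = (\<lambda>_. 0)"
  proof (rule vanishing_translate_integrals_imp_zero[OF p L(2)])
    fix z
    show "set_integrable lborel L (\<lambda>y. p (y + z))"
      unfolding interp[of z] set_integrable_def scaleR_sum_right
      using int[unfolded set_integrable_def] by (intro Bochner_Integration.integrable_sum)
    have "(LINT y:L|lborel. p (y + z)) = (\<Sum>i\<in>{1..N}. LINT y:L|lborel. l i z * p (y + \<xi> i))"
      unfolding interp[of z] set_lebesgue_integral_def scaleR_sum_right
      using int[unfolded set_integrable_def] by (intro Bochner_Integration.integral_sum)
    also have "\<dots> = 0"
      using node(2) by (intro sum.neutral) simp
    finally show "(LINT y:L|lborel. p (y + z)) = 0" .
  qed
qed

end
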